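(* Let $q$ be a prime power and let $k\ge 2$, $\ell$, $s$ be positive integers with $\ell\ge 2k-1$. Let $\underline{\alpha}_1,\ldots,\underline{\alpha}_s$ be vectors such that for every $i\in[s]$, $\underline{\alpha}_i=(\alpha_{i,1},\ldots,\alpha_{i,\ell})\in\mathbb{F}_q^\ell$ and the entries $\alpha_{i,1},\ldots,\alpha_{i,\ell}$ are pairwise distinct (entries of different vectors are allowed to coincide). Assume that for all distinct $i,j\in[s]$ one has $\mathrm{rk}\bigl(V_{k,\ell}(\underline{\alpha}_i,\underline{\alpha}_j)\bigr)=2k-1$. Then the set $$\mathcal{C}=\{\mathsf{RS}_{\ell,k}(\underline{\alpha}_i) : i\in[s]\}$$ is an $(\ell,k,q;1)$ Reed--Solomon sunflower. Moreover, for all $i,j\in[s]$ with $i\neq j$, $$\mathsf{RS}_{\ell,k}(\underline{\alpha}_i)\cap\mathsf{RS}_{\ell,k}(\underline{\alpha}_j)=\langle\underline{1}\rangle_{\mathbb{F}_q}.$$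
   Context: $[s]=\{1,\ldots,s\}$ and $\underline{1}=(1,\ldots,1)$. For $\underline{\alpha}=(\alpha_1,\ldots,\alpha_\ell)\in\mathbb{F}_q^\ell$ with pairwise distinct entries and $k\le\ell\le q$, the Reed--Solomon (RS) code is $\mathsf{RS}_{\ell,k}(\underline{\alpha})=\{(f(\alpha_1),\ldots,f(\alpha_\ell)) : f\in\mathbb{F}_q[x],\ \deg f<k\}$, a $k$-dimensional subspace of $\mathbb{F}_q^\ell$. For $1\le c<k\le\ell\le q$, a family $\{\mathsf{RS}_{\ell,k}(\underline{\alpha}_1),\ldots,\mathsf{RS}_{\ell,k}(\underline{\alpha}_s)\}$ of $k$-dimensional RS codes in $\mathbb{F}_q^\ell$ is an $(\ell,k,q;c)$ Reed--Solomon sunflower if there is a fixed $c$-dimensional subspace $E\subseteq\mathbb{F}_q^\ell$ (the center) such that $\mathsf{RS}_{\ell,k}(\underline{\alpha}_i)\cap\mathsf{RS}_{\ell,k}(\underline{\alpha}_j)=E$ for all $i\ne j$; the codes are called petals. The generalized $V$-matrix $V_{k,\ell}(\underline{X},\underline{Y})$ is the $\ell\times(2k-1)$ matrix whose $h$-th row is $(1,X_h,X_h^2,\ldots,X_h^{k-1},Y_h,Y_h^2,\ldots,Y_h^{k-1})$, for $h=1,\ldots,\ell$; $V_{k,\ell}(\underline{\alpha},\underline{\beta})$ is its evaluation at $\underline{X}=\underline{\alpha},\underline{Y}=\underline{\beta}$. *)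

theory Defs
  imports
    "Jordan_Normal_Form.DL_Rank"
    "HOL-Computational_Algebra.Polynomial"
    "HOL-Library.Cardinality"
begin

text \<open>
  The finite field with \<open>q\<close> elements is a type \<open>'a :: {field, finite}\<close> with \<open>CARD('a) = q\<close>, and
  the space of row vectors of length \<open>l\<close> over it is \<open>module_vec TYPE('a) l\<close>, whose carrier is
  \<open>carrier_vec l\<close>. Coordinates of a vector are numbered \<open>0, \<dots>, l - 1\<close>.
\<close>

abbreviation vec_subspace :: "nat \<Rightarrow> 'a :: field vec set \<Rightarrow> bool" where
  "vec_subspace l W \<equiv> VectorSpace.subspace class_ring W (module_vec TYPE('a) l)"

abbreviation vec_span :: "nat \<Rightarrow> 'a :: field vec set \<Rightarrow> 'a vec set" where
  "vec_span l S \<equiv> LinearCombinations.module.span class_ring (module_vec TYPE('a) l) S"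

abbreviation vec_subspace_dim :: "nat \<Rightarrow> 'a :: field vec set \<Rightarrow> nat" where
  "vec_subspace_dim l W \<equiv> vectorspace.dim class_ring ((module_vec TYPE('a) l)\<lparr>carrier := W\<rparr>)"

definition eval_points :: "nat \<Rightarrow> 'a vec \<Rightarrow> bool" where
  "eval_points l \<alpha> \<longleftrightarrow> \<alpha> \<in> carrier_vec l \<and> inj_on (\<lambda>h. \<alpha> $ h) {..<l}"

text \<open>The disjunct \<open>f = 0\<close> implements the convention that the zero polynomial has degree minus
  infinity (in the library its degree is \<open>0\<close>); it only matters for \<open>k = 0\<close>.\<close>

definition RS :: "nat \<Rightarrow> nat \<Rightarrow> 'a :: field vec \<Rightarrow> 'a vec set" where
  "RS l k \<alpha> = {vec l (\<lambda>h. poly f (\<alpha> $ h)) | f. f = 0 \<or> degree f < k}"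

text \<open>The petals form an indexed family, so the intersection condition ranges over all pairs of
  distinct indices; in particular, petals with distinct indices cannot coincide, because they have
  dimension \<open>k\<close> and \<open>E\<close> has dimension \<open>c < k\<close>.\<close>

definition RS_sunflower ::
  "nat \<Rightarrow> nat \<Rightarrow> nat \<Rightarrow> nat \<Rightarrow> nat \<Rightarrow> (nat \<Rightarrow> 'a :: {field, finite} vec set) \<Rightarrow> bool" where
  "RS_sunflower l k q c s C \<longleftrightarrow>
     CARD('a) = q \<and> 1 \<le> c \<and> c < k \<and> k \<le> l \<and> l \<le> q \<and>
     (\<forall>i\<in>{1..s}. vec_subspace_dim l (C i) = k \<and> (\<exists>\<alpha>. eval_points l \<alpha> \<and> C i = RS l k \<alpha>)) \<and>
     (\<exists>E. vec_subspace l E \<and> vec_subspace_dim l E = c \<and>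
          (\<forall>i\<in>{1..s}. \<forall>j\<in>{1..s}. i \<noteq> j \<longrightarrow> C i \<inter> C j = E))"

text \<open>Row \<open>h\<close> is \<open>(1, x, \<dots>, x ^ (k - 1), y, \<dots>, y ^ (k - 1))\<close> with \<open>x = \<alpha> $ h\<close>, \<open>y = \<beta> $ h\<close>.\<close>

definition V_matrix :: "nat \<Rightarrow> nat \<Rightarrow> 'a :: semiring_1 vec \<Rightarrow> 'a vec \<Rightarrow> 'a mat" where
  "V_matrix k l \<alpha> \<beta> =
     mat l (2 * k - 1) (\<lambda>(h, j). if j < k then (\<alpha> $ h) ^ j else (\<beta> $ h) ^ (j - k + 1))"

end

theory Submission
  imports Defs
begin

text \<open>
  Write a word of \<open>RS l k \<alpha>\<close> as \<open>f(\<alpha>)\<close> with \<open>deg f < k\<close>. A common word of two petals is a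
  solution of \<open>f(\<alpha>) = g(\<beta>)\<close>, coordinate by coordinate. Collecting the two constant terms into one
  unknown, this is a homogeneous linear system in the \<open>2 * k - 1\<close> unknowns \<open>f\<^sub>0 - g\<^sub>0\<close>,
  \<open>f\<^sub>1, \<dots>, f\<^bsub>k-1\<^esub>\<close>, \<open>- g\<^sub>1, \<dots>, - g\<^bsub>k-1\<^esub>\<close>, and its matrix is exactly \<open>V_matrix k l \<alpha> \<beta>\<close>. Full column
  rank leaves only the zero solution, so \<open>f\<close> and \<open>g\<close> are the same constant and the common word is a
  multiple of the all-one vector; conversely every constant word lies in every petal
  (\<open>RS_inter_eq_constants\<close>).

  The dimensions rest on the same link between rank and kernel (\<open>rank_eq_dim_col_iff\<close>), now
  for the Vandermonde matrix, whose columns span \<open>RS l k \<alpha>\<close>: an element of its kernel is a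
  polynomial of degree below \<open>k\<close> vanishing at \<open>l \<ge> k\<close> distinct points (\<open>vec_subspace_dim_RS\<close>).
  The center needs no separate treatment, since the constant words form the code \<open>RS l 1 \<alpha>\<close>.
\<close>

section \<open>Full column rank\<close>

text \<open>Repeated columns must be dealt with separately in both directions, because the rank is
  defined through the set of columns: a repetition lowers the rank below the number of columns, and
  it yields a difference of two unit vectors in the kernel.\<close>

lemma (in vec_space) rank_eq_dim_col_iff:
  assumes A: "A \<in> carrier_mat n nc"
  shows "rank A = nc \<longleftrightarrow> (\<forall>v\<in>carrier_vec nc. A *\<^sub>v v = 0\<^sub>v n \<longrightarrow> v = 0\<^sub>v nc)"
proof
  assume rank: "rank A = nc"
  have "distinct (cols A)"
  proof -
    obtain S where S: "maximal S (\<lambda>T. T \<subseteq> set (cols A) \<and> lin_indpt T)"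
      using maximal_exists_superset[of "set (cols A)" "\<lambda>T. T \<subseteq> set (cols A) \<and> lin_indpt T" "{}"]
      by (auto simp: lin_dep_def)
    then have "nc = card S"
      using rank rank_card_indpt[OF A] by simp
    also have "\<dots> \<le> card (set (cols A))"
      using S by (intro card_mono) (auto simp: maximal_def)
    finally show ?thesis
      using A card_length[of "cols A"] by (intro card_distinct) auto
  qed
  then show "\<forall>v\<in>carrier_vec nc. A *\<^sub>v v = 0\<^sub>v n \<longrightarrow> v = 0\<^sub>v nc"
    using full_rank_lin_indpt[OF A rank] lin_depI[OF A] by blast
next
  assume ker: "\<forall>v\<in>carrier_vec nc. A *\<^sub>v v = 0\<^sub>v n \<longrightarrow> v = 0\<^sub>v nc"
  have distinct: "distinct (cols A)"
    unfolding distinct_conv_nth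
  proof (intro allI impI notI)
    fix i j
    assume "i < length (cols A)" "j < length (cols A)" and ne: "i \<noteq> j"
      and eq: "cols A ! i = cols A ! j"
    then have i: "i < nc" and j: "j < nc" and col: "col A i = col A j"
      using A by auto
    have mult_unit_vec: "A *\<^sub>v unit_vec nc i = col A i" if "i < nc" for i
      using A that by (intro eq_vecI) auto
    have "A *\<^sub>v (unit_vec nc i - unit_vec nc j) = A *\<^sub>v unit_vec nc i - A *\<^sub>v unit_vec nc j"
      using A by (intro mult_minus_distrib_mat_vec) auto
    also have "\<dots> = col A i - col A j"
      using mult_unit_vec[OF i] mult_unit_vec[OF j] by simp
    also have "\<dots> = 0\<^sub>v n"
      using A col by auto
    finally have "(unit_vec nc i - unit_vec nc j :: 'a vec) = 0\<^sub>v nc"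
      using ker by simp
    then have "(unit_vec nc i - unit_vec nc j :: 'a vec) $ i = 0"
      using i by simp
    then show False
      using i j ne by simp
  qed
  have "lin_indpt (set (cols A))"
    using lin_depE[OF A _ distinct] ker by metis
  then show "rank A = nc"
    using lin_indpt_full_rank[OF A distinct] by simp
qed

section \<open>Reed--Solomon codes as column spaces\<close>

lemma poly_eq_sum_lessThan:
  fixes f :: "'a :: comm_semiring_1 poly"
  assumes "f = 0 \<or> degree f < k"
  shows "poly f x = (\<Sum>j<k. coeff f j * x ^ j)"
proof (cases "f = 0")
  case False
  then have "{..degree f} \<subseteq> {..<k}"
    using assms by auto
  then show ?thesis
    unfolding poly_altdef by (intro sum.mono_neutral_left) (auto simp: coeff_eq_0)
qed simp

lemma coeff_sum_monom:
  "coeff (\<Sum>j<k. monom (c j) j) i = (if i < k then c i else 0)"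
  by (simp add: coeff_sum)

lemma degree_sum_monom_less:
  assumes "k > 0"
  shows "degree (\<Sum>j<k. monom (c j) j) < k"
  using assms by (intro le_less_trans[OF degree_le[of "k - 1"]]) (auto simp: coeff_sum_monom)

lemma in_RS_iff:
  "w \<in> RS l k \<alpha> \<longleftrightarrow> (\<exists>c. w = vec l (\<lambda>h. \<Sum>j<k. c j * (\<alpha> $ h) ^ j))"
proof
  assume "w \<in> RS l k \<alpha>"
  then obtain f where "w = vec l (\<lambda>h. poly f (\<alpha> $ h))" "f = 0 \<or> degree f < k"
    by (auto simp: RS_def)
  then show "\<exists>c. w = vec l (\<lambda>h. \<Sum>j<k. c j * (\<alpha> $ h) ^ j)"
    by (auto simp: poly_eq_sum_lessThan intro!: exI[of _ "coeff f"])
next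
  assume "\<exists>c. w = vec l (\<lambda>h. \<Sum>j<k. c j * (\<alpha> $ h) ^ j)"
  then obtain c where w: "w = vec l (\<lambda>h. \<Sum>j<k. c j * (\<alpha> $ h) ^ j)" ..
  define f where "f = (\<Sum>j<k. monom (c j) j)"
  have "f = 0 \<or> degree f < k"
    by (cases "k = 0") (auto simp: f_def degree_sum_monom_less)
  moreover have "w = vec l (\<lambda>h. poly f (\<alpha> $ h))"
    by (simp add: w f_def poly_sum poly_monom)
  ultimately show "w \<in> RS l k \<alpha>"
    unfolding RS_def by blast
qed

definition vandermonde :: "nat \<Rightarrow> nat \<Rightarrow> 'a :: semiring_1 vec \<Rightarrow> 'a mat" where
  "vandermonde l k \<alpha> = mat l k (\<lambda>(h, j). (\<alpha> $ h) ^ j)"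

lemma vandermonde_carrier [simp]: "vandermonde l k \<alpha> \<in> carrier_mat l k"
  by (simp add: vandermonde_def)

lemma vandermonde_mult_vec:
  fixes \<alpha> :: "'a :: comm_semiring_1 vec"
  assumes "v \<in> carrier_vec k"
  shows "vandermonde l k \<alpha> *\<^sub>v v = vec l (\<lambda>h. \<Sum>j<k. v $ j * (\<alpha> $ h) ^ j)"
  using assms
  by (intro eq_vecI)
    (auto simp: vandermonde_def scalar_prod_def mult.commute atLeast0LessThan intro!: sum.cong)

lemma RS_eq_span_cols: "RS l k \<alpha> = vec_span l (set (cols (vandermonde l k \<alpha>)))"
proof -
  interpret vec_space "TYPE('a)" l .
  have "w \<in> RS l k \<alpha> \<longleftrightarrow> (\<exists>v\<in>carrier_vec k. vandermonde l k \<alpha> *\<^sub>v v = w)" for w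
  proof
    assume "w \<in> RS l k \<alpha>"
    then obtain c where "w = vec l (\<lambda>h. \<Sum>j<k. c j * (\<alpha> $ h) ^ j)"
      by (auto simp: in_RS_iff)
    then show "\<exists>v\<in>carrier_vec k. vandermonde l k \<alpha> *\<^sub>v v = w"
      by (intro bexI[of _ "vec k c"]) (auto simp: vandermonde_mult_vec)
  next
    assume "\<exists>v\<in>carrier_vec k. vandermonde l k \<alpha> *\<^sub>v v = w"
    then show "w \<in> RS l k \<alpha>"
      by (auto simp: in_RS_iff vandermonde_mult_vec)
  qed
  then show ?thesis
    using col_space_eq[OF vandermonde_carrier[of l k \<alpha>]] vandermonde_carrier[of l k \<alpha>]
    by (auto simp: col_space_def vandermonde_mult_vec)
qed

lemma vec_subspace_RS: "vec_subspace l (RS l k \<alpha>)"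
proof -
  interpret vec_space "TYPE('a)" l .
  have "set (cols (vandermonde l k \<alpha>)) \<subseteq> carrier_vec l"
    using cols_dim[of "vandermonde l k \<alpha>"] by (simp add: vandermonde_def)
  then show ?thesis
    unfolding RS_eq_span_cols by (rule span_is_subspace)
qed

text \<open>A nonzero polynomial of degree below \<open>k\<close> has fewer than \<open>k\<close> roots, so it cannot vanish at \<open>l \<ge> k\<close>
  distinct points. Hence the Vandermonde matrix has trivial kernel and full column rank.\<close>

lemma vec_subspace_dim_RS:
  assumes points: "eval_points l \<alpha>" and "k \<le> l"
  shows "vec_subspace_dim l (RS l k \<alpha>) = k"
proof -
  interpret vec_space "TYPE('a)" l .
  have "v = 0\<^sub>v k" if v: "v \<in> carrier_vec k" and ker: "vandermonde l k \<alpha> *\<^sub>v v = 0\<^sub>v l" for v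
  proof -
    define f where "f = (\<Sum>j<k. monom (v $ j) j)"
    have roots: "poly f (\<alpha> $ h) = 0" if "h < l" for h
    proof -
      have "poly f (\<alpha> $ h) = (vandermonde l k \<alpha> *\<^sub>v v) $ h"
        using that v by (simp add: vandermonde_mult_vec f_def poly_sum poly_monom)
      then show ?thesis
        using that ker by simp
    qed
    have "f = 0"
    proof (rule ccontr)
      assume "f \<noteq> 0"
      then have "k > 0"
        by (auto simp: f_def intro: ccontr)
      have "l = card ((\<lambda>h. \<alpha> $ h) ` {..<l})"
        using points by (simp add: eval_points_def card_image)
      also have "\<dots> \<le> card {x. poly f x = 0}"
        using roots \<open>f \<noteq> 0\<close> by (intro card_mono) (auto simp: poly_roots_finite)
      also have "\<dots> \<le> degree f"
        using \<open>f \<noteq> 0\<close> by (rule card_poly_roots_bound)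
      also have "\<dots> < k"
        unfolding f_def using \<open>k > 0\<close> by (rule degree_sum_monom_less)
      finally show False
        using \<open>k \<le> l\<close> by simp
    qed
    then have "v $ j = 0" if "j < k" for j
      using coeff_sum_monom[of "\<lambda>j. v $ j" k j] that by (simp add: f_def)
    then show ?thesis
      using v by (intro eq_vecI) auto
  qed
  then have "rank (vandermonde l k \<alpha>) = k"
    using rank_eq_dim_col_iff[OF vandermonde_carrier] by blast
  then show ?thesis
    by (simp add: rank_def RS_eq_span_cols)
qed

lemma RS_one_eq_span: "RS l 1 \<alpha> = vec_span l {vec l (\<lambda>_. 1)}"
proof -
  have "cols (vandermonde l 1 \<alpha>) = [vec l (\<lambda>_. 1)]"
    by (auto simp: vandermonde_def cols_def intro!: eq_vecI)
  then show ?thesis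
    by (simp add: RS_eq_span_cols)
qed

section \<open>The intersection of two petals\<close>

lemma RS_mono:
  assumes "k \<le> k'"
  shows "RS l k \<alpha> \<subseteq> RS l k' \<alpha>"
  using assms by (fastforce simp: RS_def)

text \<open>The difference of the two polynomials with coefficients \<open>c\<close> and \<open>d\<close>, evaluated at \<open>\<alpha>\<close> and \<open>\<beta>\<close>,
  is linear in \<open>v\<close>. The constant terms share one entry because the monomial \<open>1\<close> occurs only once in
  the \<open>V\<close>-matrix; the shift \<open>j - k + 1\<close> skips the constant coefficient of the second polynomial.\<close>

lemma V_matrix_mult_coeffs:
  fixes \<alpha> \<beta> :: "'a :: comm_ring_1 vec" and c d :: "nat \<Rightarrow> 'a"
  assumes "k > 0" and "h < l"
  defines "v \<equiv> vec (2 * k - 1)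
    (\<lambda>j. if j = 0 then c 0 - d 0 else if j < k then c j else - d (j - k + 1))"
  shows "(V_matrix k l \<alpha> \<beta> *\<^sub>v v) $ h
    = (\<Sum>j<k. c j * (\<alpha> $ h) ^ j) - (\<Sum>j<k. d j * (\<beta> $ h) ^ j)"
proof -
  obtain m where k: "k = Suc m"
    using \<open>k > 0\<close> by (cases k) auto
  have split: "sum g {..<m + n} = sum g {..<m} + (\<Sum>i<n. g (m + i))"
    for g :: "nat \<Rightarrow> 'a" and n
    by (induction n) (simp_all add: add.assoc)
  let ?g = "\<lambda>j. (if j < k then (\<alpha> $ h) ^ j else (\<beta> $ h) ^ (j - k + 1)) *
    (if j = 0 then c 0 - d 0 else if j < k then c j else - d (j - k + 1))"
  have "(V_matrix k l \<alpha> \<beta> *\<^sub>v v) $ h = sum ?g {..<Suc (m + m)}"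
    using \<open>h < l\<close>
    by (auto simp: V_matrix_def v_def scalar_prod_def k atLeast0LessThan mult_2 intro!: sum.cong)
  also have "\<dots> = ?g 0 + ((\<Sum>i<m. ?g (Suc i)) + (\<Sum>i<m. ?g (Suc (m + i))))"
    by (simp only: sum.lessThan_Suc_shift split)
  also have "\<dots> = (c 0 - d 0) + ((\<Sum>i<m. c (Suc i) * (\<alpha> $ h) ^ Suc i)
      - (\<Sum>i<m. d (Suc i) * (\<beta> $ h) ^ Suc i))"
    by (simp add: k sum_negf mult.commute)
  also have "\<dots> = (\<Sum>j<k. c j * (\<alpha> $ h) ^ j) - (\<Sum>j<k. d j * (\<beta> $ h) ^ j)"
    by (simp add: k sum.lessThan_Suc_shift del: sum.lessThan_Suc)
  finally show ?thesis .
qed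

lemma RS_inter_eq_constants:
  fixes \<alpha> \<beta> :: "'a :: field vec"
  assumes "k > 0" and rank: "vec_space.rank l (V_matrix k l \<alpha> \<beta>) = 2 * k - 1"
  shows "RS l k \<alpha> \<inter> RS l k \<beta> = vec_span l {vec l (\<lambda>_. 1)}"
proof
  interpret vec_space "TYPE('a)" l .
  have V: "V_matrix k l \<alpha> \<beta> \<in> carrier_mat l (2 * k - 1)"
    by (simp add: V_matrix_def)
  show "RS l k \<alpha> \<inter> RS l k \<beta> \<subseteq> span {vec l (\<lambda>_. 1)}"
  proof
    fix w
    assume "w \<in> RS l k \<alpha> \<inter> RS l k \<beta>"
    then obtain c d where c: "w = vec l (\<lambda>h. \<Sum>j<k. c j * (\<alpha> $ h) ^ j)"
      and d: "w = vec l (\<lambda>h. \<Sum>j<k. d j * (\<beta> $ h) ^ j)"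
      unfolding Int_iff in_RS_iff by blast
    define v where "v = vec (2 * k - 1)
      (\<lambda>j. if j = 0 then c 0 - d 0 else if j < k then c j else - d (j - k + 1))"
    have "(V_matrix k l \<alpha> \<beta> *\<^sub>v v) $ h = w $ h - w $ h" if "h < l" for h
    proof -
      have "w $ h = (\<Sum>j<k. c j * (\<alpha> $ h) ^ j)"
        using that by (subst c) simp
      moreover have "w $ h = (\<Sum>j<k. d j * (\<beta> $ h) ^ j)"
        using that by (subst d) simp
      ultimately show ?thesis
        using V_matrix_mult_coeffs[OF \<open>k > 0\<close> that, of \<alpha> \<beta> c d] by (simp add: v_def)
    qed
    then have "V_matrix k l \<alpha> \<beta> *\<^sub>v v = 0\<^sub>v l"
      using V by (intro eq_vecI) auto
    then have v: "v = 0\<^sub>v (2 * k - 1)"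
      using rank rank_eq_dim_col_iff[OF V] by (simp add: v_def)
    have c0: "c j = 0" if "0 < j" "j < k" for j
    proof -
      have "v $ j = c j"
        using that by (simp add: v_def)
      then show ?thesis
        using that by (simp add: v)
    qed
    have "(\<Sum>j<k. c j * x ^ j) = (\<Sum>j<1. c j * x ^ j)" for x
      using \<open>k > 0\<close> c0 by (intro sum.mono_neutral_right) auto
    then have "w \<in> RS l 1 \<alpha>"
      unfolding in_RS_iff c by auto
    then show "w \<in> span {vec l (\<lambda>_. 1)}"
      by (simp only: RS_one_eq_span)
  qed
  show "span {vec l (\<lambda>_. 1)} \<subseteq> RS l k \<alpha> \<inter> RS l k \<beta>"
    using RS_mono[of 1 k l \<alpha>] RS_mono[of 1 k l \<beta>] \<open>k > 0\<close>
    unfolding RS_one_eq_span by simp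
qed

section \<open>The sunflower\<close>

theorem theorem2p6:
  fixes q k l s :: nat
    and \<alpha> :: "nat \<Rightarrow> 'a :: {field, finite} vec"
  assumes "CARD('a) = q"
    and "k \<ge> 2" and "l \<ge> 1" and "s \<ge> 1"
    and "l \<ge> 2 * k - 1"
    and "\<forall>i\<in>{1..s}. eval_points l (\<alpha> i)"
    and "\<forall>i\<in>{1..s}. \<forall>j\<in>{1..s}. i \<noteq> j \<longrightarrow>
           vec_space.rank l (V_matrix k l (\<alpha> i) (\<alpha> j)) = 2 * k - 1"
  shows "RS_sunflower l k q 1 s (\<lambda>i. RS l k (\<alpha> i)) \<and>
         (\<forall>i\<in>{1..s}. \<forall>j\<in>{1..s}. i \<noteq> j \<longrightarrow>
            RS l k (\<alpha> i) \<inter> RS l k (\<alpha> j) = vec_span l {vec l (\<lambda>_. 1)})"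
proof -
  let ?E = "vec_span l {vec l (\<lambda>_. 1 :: 'a)}"
  have inter: "\<forall>i\<in>{1..s}. \<forall>j\<in>{1..s}. i \<noteq> j \<longrightarrow> RS l k (\<alpha> i) \<inter> RS l k (\<alpha> j) = ?E"
    using assms(2,7) by (simp add: RS_inter_eq_constants)
  have "k \<le> l"
    using assms(2,5) by linarith
  have petals: "\<forall>i\<in>{1..s}. vec_subspace_dim l (RS l k (\<alpha> i)) = k \<and>
      (\<exists>\<beta>. eval_points l \<beta> \<and> RS l k (\<alpha> i) = RS l k \<beta>)"
    using assms(6) \<open>k \<le> l\<close> vec_subspace_dim_RS by blast
  have points: "eval_points l (\<alpha> 1)"
    using assms(4,6) by simp
  have "l = card ((\<lambda>h. \<alpha> 1 $ h) ` {..<l})"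
    using points by (simp add: eval_points_def card_image)
  also have "\<dots> \<le> q"
    unfolding assms(1)[symmetric] by (intro card_mono) auto
  finally have "l \<le> q" .
  have center: "vec_subspace l ?E" "vec_subspace_dim l ?E = 1"
    using vec_subspace_RS[of l 1 "\<alpha> 1"] vec_subspace_dim_RS[OF points assms(3)]
    unfolding RS_one_eq_span by simp_all
  have "RS_sunflower l k q 1 s (\<lambda>i. RS l k (\<alpha> i))"
    unfolding RS_sunflower_def
    using assms(1,2) \<open>k \<le> l\<close> \<open>l \<le> q\<close> petals center inter by (intro conjI) auto
  then show ?thesis
    using inter by blast
qed

end
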